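(* For every integer $n \geq 5$, the smallest positive integer $k$ for which there exists a proper edge coloring $f: E(H_n) \to \{1,2,\dots,k\}$ such that all vertices of $H_n$ are distinguished by $f$ is $k = n$.
   Context: The $n$-dimensional hypercube $H_n$ is the graph whose vertices are the binary sequences of length $n$, two vertices being adjacent if the sequences differ in exactly one position; if they differ in position $i$, the edge is said to be of dimension $i$. For a vertex $x$ of $H_n$, let $e_i(x)$ denote the unique edge of dimension $i$ incident to $x$. For an edge coloring $f: E(H_n) \to \{1,\dots,k\}$, the palette at $x$ is the sequence $F(x) = (f(e_1(x)), f(e_2(x)), \dots, f(e_n(x)))$. All vertices are distinguished by $f$ if the palettes of any two distinct vertices are different sequences. An edge coloring is proper if any two edges sharing a vertex receive different colors. *)

theory Defs
  imports Main
begin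

text \<open>
  Vertices of the \<open>n\<close>-dimensional hypercube are Boolean lists of length \<open>n\<close>, and edges are
  two-element sets of vertices. Positions (dimensions) are numbered \<open>0, \<dots>, n - 1\<close>, in
  accordance with list indexing; colours are the natural numbers \<open>1, \<dots>, k\<close>.
\<close>

definition cube_verts :: "nat \<Rightarrow> bool list set" where
  "cube_verts n = {x. length x = n}"

definition cube_adj :: "nat \<Rightarrow> bool list \<Rightarrow> bool list \<Rightarrow> bool" where
  "cube_adj n x y \<longleftrightarrow>
     x \<in> cube_verts n \<and> y \<in> cube_verts n \<and> (\<exists>!i. i < n \<and> x ! i \<noteq> y ! i)"

definition cube_edges :: "nat \<Rightarrow> bool list set set" where
  "cube_edges n = {{x, y} | x y. cube_adj n x y}"

definition edge_has_dim :: "nat \<Rightarrow> nat \<Rightarrow> bool list set \<Rightarrow> bool" where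
  "edge_has_dim n i e \<longleftrightarrow>
     e \<in> cube_edges n \<and> i < n \<and> (\<exists>x y. e = {x, y} \<and> x ! i \<noteq> y ! i)"

definition edge_at :: "nat \<Rightarrow> nat \<Rightarrow> bool list \<Rightarrow> bool list set" where
  "edge_at n i x = (THE e. edge_has_dim n i e \<and> x \<in> e)"

lemma edge_at_unique:
  assumes x: "x \<in> cube_verts n" and i: "i < n"
  shows "edge_has_dim n i e \<and> x \<in> e \<longleftrightarrow> e = {x, x[i := \<not> x ! i]}"
proof
  assume "edge_has_dim n i e \<and> x \<in> e"
  then obtain a b c d where e: "e = {a, b}" "cube_adj n a b" "x \<in> e"
      "e = {c, d}" "c ! i \<noteq> d ! i"
    unfolding edge_has_dim_def cube_edges_def by blast
  have "\<exists>y. e = {x, y} \<and> cube_adj n x y"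
  proof (cases "x = a")
    case True
    with e show ?thesis by blast
  next
    case False
    with e have "x = b" by blast
    with e have "e = {x, a}" "cube_adj n x a"
      unfolding cube_adj_def by (auto simp: eq_commute)
    then show ?thesis by blast
  qed
  then obtain y where y: "e = {x, y}" "cube_adj n x y" by blast
  have "x ! i \<noteq> y ! i"
    using e(4,5) y(1) by (metis doubleton_eq_iff)
  then have "\<forall>j<n. j \<noteq> i \<longrightarrow> x ! j = y ! j"
    using y(2) i unfolding cube_adj_def by blast
  with \<open>x ! i \<noteq> y ! i\<close> have "y = x[i := \<not> x ! i]"
    using y(2) i unfolding cube_adj_def cube_verts_def
    by (intro nth_equalityI) (auto simp: nth_list_update)
  with y show "e = {x, x[i := \<not> x ! i]}" by simp
next
  assume e: "e = {x, x[i := \<not> x ! i]}"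
  have len: "length x = n" using x by (simp add: cube_verts_def)
  have "\<exists>!j. j < n \<and> x ! j \<noteq> x[i := \<not> x ! i] ! j"
    by (rule ex1I[of _ i]) (use i len in \<open>auto simp: nth_list_update split: if_splits\<close>)
  then have "cube_adj n x (x[i := \<not> x ! i])"
    using len by (simp add: cube_adj_def cube_verts_def)
  moreover have "x ! i \<noteq> x[i := \<not> x ! i] ! i" using i len by simp
  ultimately show "edge_has_dim n i e \<and> x \<in> e"
    unfolding edge_has_dim_def cube_edges_def using e i by blast
qed

lemma edge_at_eq:
  assumes "x \<in> cube_verts n" "i < n"
  shows "edge_at n i x = {x, x[i := \<not> x ! i]}"
  unfolding edge_at_def using edge_at_unique[OF assms] by simp

definition edge_coloring :: "nat \<Rightarrow> nat \<Rightarrow> (bool list set \<Rightarrow> nat) \<Rightarrow> bool" where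
  "edge_coloring n k f \<longleftrightarrow> f ` cube_edges n \<subseteq> {1..k}"

definition proper_coloring :: "nat \<Rightarrow> (bool list set \<Rightarrow> nat) \<Rightarrow> bool" where
  "proper_coloring n f \<longleftrightarrow>
     (\<forall>e\<in>cube_edges n. \<forall>e'\<in>cube_edges n. e \<noteq> e' \<and> e \<inter> e' \<noteq> {} \<longrightarrow> f e \<noteq> f e')"

definition palette :: "nat \<Rightarrow> (bool list set \<Rightarrow> nat) \<Rightarrow> bool list \<Rightarrow> nat list" where
  "palette n f x = map (\<lambda>i. f (edge_at n i x)) [0..<n]"

definition distinguishes_vertices :: "nat \<Rightarrow> (bool list set \<Rightarrow> nat) \<Rightarrow> bool" where
  "distinguishes_vertices n f \<longleftrightarrow>
     (\<forall>x\<in>cube_verts n. \<forall>y\<in>cube_verts n. x \<noteq> y \<longrightarrow> palette n f x \<noteq> palette n f y)"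

definition distinguishing_proper_colorable :: "nat \<Rightarrow> nat \<Rightarrow> bool" where
  "distinguishing_proper_colorable n k \<longleftrightarrow>
     (\<exists>f. edge_coloring n k f \<and> proper_coloring n f \<and> distinguishes_vertices n f)"

end

theory Submission
  imports Defs "HOL-Combinatorics.Transposition"
begin

text \<open>
  Every vertex has degree \<open>n\<close>, so \<open>n\<close> colours are needed. Conversely, suppose \<open>n\<close> colours suffice
  for \<open>H\<^sub>n\<close> and exchanging two colours \<open>a\<close>, \<open>b\<close> turns no palette into a palette. Colour one half
  of \<open>H\<^sub>n\<^sub>+\<^sub>1\<close> as \<open>H\<^sub>n\<close>, the other half with \<open>a\<close> and \<open>b\<close> exchanged, and give all edges between the
  halves the new colour \<open>n + 1\<close>. Since one dimension is now constantly coloured \<open>n + 1\<close>, exchanging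
  \<open>1\<close> and \<open>n + 1\<close> turns no palette of this colouring into a palette, so the construction can be
  iterated. It starts from a colouring of \<open>H\<^sub>5\<close> found by a SAT solver.
\<close>

definition flip :: "nat \<Rightarrow> bool list \<Rightarrow> bool list" where
  "flip i x = x[i := \<not> x ! i]"

text \<open>A colouring with \<open>n\<close> colours is represented by its palettes. The condition
  on \<open>flip i x\<close> makes the two ends of each edge agree on its colour,
  \<open>distinct\<close> encodes properness and \<open>inj_on\<close> that all vertices are
  distinguished.\<close>

definition distinguishing_palettes :: "nat \<Rightarrow> (bool list \<Rightarrow> nat list) \<Rightarrow> bool" where
  "distinguishing_palettes n p \<longleftrightarrow>
     (\<forall>x\<in>cube_verts n. length (p x) = n \<and> distinct (p x) \<and> set (p x) \<subseteq> {1..n} \<and>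
        (\<forall>i<n. p (flip i x) ! i = p x ! i)) \<and>
     inj_on p (cube_verts n)"

definition swap_free :: "nat \<Rightarrow> (bool list \<Rightarrow> nat list) \<Rightarrow> nat \<Rightarrow> nat \<Rightarrow> bool" where
  "swap_free n p a b \<longleftrightarrow>
     (\<forall>x\<in>cube_verts n. \<forall>y\<in>cube_verts n. map (transpose a b) (p x) \<noteq> p y)"

lemma edge_at_flip:
  "x \<in> cube_verts n \<Longrightarrow> i < n \<Longrightarrow> edge_at n i x = {x, flip i x}"
  by (simp add: edge_at_eq flip_def)

lemma edge_at_in_cube_edges:
  assumes "x \<in> cube_verts n" "i < n"
  shows "edge_at n i x \<in> cube_edges n"
  using edge_at_unique[OF assms] edge_at_eq[OF assms] by (auto simp: edge_has_dim_def)

lemma inj_on_edge_at: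
  assumes "x \<in> cube_verts n"
  shows "inj_on (\<lambda>i. edge_at n i x) {..<n}"
proof (rule inj_onI)
  fix i j assume *: "i \<in> {..<n}" "j \<in> {..<n}" "edge_at n i x = edge_at n j x"
  then have "flip i x = flip j x"
    using assms by (auto simp: edge_at_flip doubleton_eq_iff)
  \<comment> \<open>Flipping position \<open>i\<close> changes this entry, flipping position
    \<open>j\<close> changes it only if \<open>j = i\<close>.\<close>
  then have "flip i x ! i = flip j x ! i" by simp
  then show "i = j"
    using * assms by (auto simp: flip_def cube_verts_def nth_list_update split: if_splits)
qed

lemma edge_eq_edge_at:
  assumes "e \<in> cube_edges n" "x \<in> e"
  obtains i where "x \<in> cube_verts n" "i < n" "e = edge_at n i x"
proof -
  obtain a b where ab: "e = {a, b}" "cube_adj n a b"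
    using assms by (auto simp: cube_edges_def)
  then obtain i where i: "i < n" "a ! i \<noteq> b ! i"
    by (auto simp: cube_adj_def)
  have x: "x \<in> cube_verts n"
    using ab assms by (auto simp: cube_adj_def)
  have "edge_has_dim n i e"
    using ab i assms by (auto simp: edge_has_dim_def)
  then have "e = edge_at n i x"
    using edge_at_unique[OF x i(1)] edge_at_eq[OF x i(1)] assms by blast
  with x i that show thesis by blast
qed

text \<open>The \<open>n\<close> edges at one vertex are distinct and meet pairwise, so a proper
  colouring is injective on them.\<close>

lemma proper_coloring_degree_le:
  assumes "edge_coloring n k f" "proper_coloring n f"
  shows "n \<le> k"
proof -
  define x where "x = replicate n False"
  have x: "x \<in> cube_verts n" by (simp add: x_def cube_verts_def)
  have "inj_on (\<lambda>i. f (edge_at n i x)) {..<n}"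
  proof (rule inj_onI)
    fix i j assume *: "i \<in> {..<n}" "j \<in> {..<n}" "f (edge_at n i x) = f (edge_at n j x)"
    have "edge_at n i x \<inter> edge_at n j x \<noteq> {}"
      using * x by (simp add: edge_at_flip)
    then have "edge_at n i x = edge_at n j x"
      using * assms(2) edge_at_in_cube_edges[OF x] unfolding proper_coloring_def by blast
    then show "i = j" using inj_onD[OF inj_on_edge_at[OF x]] * by blast
  qed
  moreover have "(\<lambda>i. f (edge_at n i x)) ` {..<n} \<subseteq> {1..k}"
    using assms(1) edge_at_in_cube_edges[OF x] by (auto simp: edge_coloring_def)
  ultimately show ?thesis
    using card_inj_on_le[of _ "{..<n}" "{1..k}"] by simp
qed

lemma colorable_if_distinguishing_palettes:
  assumes "distinguishing_palettes n p"
  shows "distinguishing_proper_colorable n n"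
proof -
  \<comment> \<open>The colour of an edge is read off the palette of an arbitrarily chosen end, at
    the only position where the two ends differ. As the ends agree there, the choice is
    immaterial.\<close>
  define f where
    "f e = p (SOME x. x \<in> e) ! (THE i. i < n \<and> (\<exists>x\<in>e. \<exists>y\<in>e. x ! i \<noteq> y ! i))" for e
  have p: "length (p x) = n" "distinct (p x)" "set (p x) \<subseteq> {1..n}"
      "\<And>i. i < n \<Longrightarrow> p (flip i x) ! i = p x ! i" if "x \<in> cube_verts n" for x
    using assms that by (auto simp: distinguishing_palettes_def)
  have f: "f (edge_at n i x) = p x ! i" if x: "x \<in> cube_verts n" and i: "i < n" for x i
  proof -
    have "(THE j. j < n \<and> (\<exists>y\<in>{x, flip i x}. \<exists>z\<in>{x, flip i x}. y ! j \<noteq> z ! j)) = i"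
      using x i by (intro the_equality)
        (auto simp: flip_def cube_verts_def nth_list_update split: if_splits)
    moreover have "(SOME y. y \<in> {x, flip i x}) \<in> {x, flip i x}"
      by (rule someI[of _ x]) simp
    ultimately show ?thesis
      using p(4)[OF x i] x i by (auto simp: f_def edge_at_flip)
  qed
  have "edge_coloring n n f"
  proof -
    have "f e \<in> {1..n}" if "e \<in> cube_edges n" for e
    proof -
      obtain x where "x \<in> e" using \<open>e \<in> cube_edges n\<close> by (auto simp: cube_edges_def)
      with that obtain i where i: "x \<in> cube_verts n" "i < n" "e = edge_at n i x"
        by (rule edge_eq_edge_at)
      then have "p x ! i \<in> set (p x)" using p(1) by simp
      with i p(3) f show ?thesis by fastforce
    qed
    then show ?thesis by (auto simp: edge_coloring_def)
  qed
  moreover have "proper_coloring n f"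
    unfolding proper_coloring_def
  proof (intro ballI impI)
    fix e e' assume e: "e \<in> cube_edges n" "e' \<in> cube_edges n" "e \<noteq> e' \<and> e \<inter> e' \<noteq> {}"
    then obtain x where x: "x \<in> e" "x \<in> e'" by blast
    obtain i where i: "x \<in> cube_verts n" "i < n" "e = edge_at n i x"
      using e(1) x(1) by (rule edge_eq_edge_at)
    obtain j where j: "j < n" "e' = edge_at n j x"
      using e(2) x(2) by (rule edge_eq_edge_at)
    have "i \<noteq> j" using e i j by blast
    then show "f e \<noteq> f e'"
      using i j p(1,2) f by (simp add: nth_eq_iff_index_eq)
  qed
  moreover have "palette n f x = p x" if "x \<in> cube_verts n" for x
    using that p(1) f by (intro nth_equalityI) (auto simp: palette_def)
  then have "distinguishes_vertices n f"
    using assms unfolding distinguishes_vertices_def distinguishing_palettes_def inj_on_def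
    by metis
  ultimately show ?thesis
    unfolding distinguishing_proper_colorable_def by blast
qed

lemma cube_verts_Suc: "cube_verts (Suc n) = (\<lambda>(b, x). b # x) ` (UNIV \<times> cube_verts n)"
  by (auto simp: cube_verts_def length_Suc_conv image_iff)

text \<open>The Boolean \<open>c\<close> tells which half a vertex lies in. The new dimension comes
  first, so position \<open>Suc i\<close> of a new palette stems from position \<open>i\<close> of
  an old one.\<close>

fun double :: "nat \<Rightarrow> nat \<Rightarrow> nat \<Rightarrow> (bool list \<Rightarrow> nat list) \<Rightarrow> bool list \<Rightarrow> nat list" where
  "double n a b p (c # x) = Suc n # (if c then map (transpose a b) (p x) else p x)"
| "double n a b p [] = []"

text \<open>Within one half, palettes differ because both \<open>p\<close> and the exchange of
  colours are injective; across the halves they differ by \<open>swap_free\<close>. The second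
  conclusion permits the next doubling.\<close>

lemma distinguishing_palettes_double:
  assumes p: "distinguishing_palettes n p" and s: "swap_free n p a b"
    and ab: "a \<in> {1..n}" "b \<in> {1..n}"
  shows "distinguishing_palettes (Suc n) (double n a b p)"
    and "swap_free (Suc n) (double n a b p) 1 (Suc n)"
proof -
  have inj: "inj (map (transpose a b))"
    by (simp add: inj_mapI)
  have set_sub: "transpose a b ` A \<subseteq> {1..n}" if "A \<subseteq> {1..n}" for A
    using that ab by (auto simp: transpose_def)
  have flip_Suc: "flip (Suc i) (c # x) = c # flip i x" for i c x
    by (simp add: flip_def)
  have flip_verts: "flip i x \<in> cube_verts n" if "x \<in> cube_verts n" for i x
    using that by (simp add: flip_def cube_verts_def)
  have vertex: "length (double n a b p x) = Suc n \<and> distinct (double n a b p x) \<and>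
      set (double n a b p x) \<subseteq> {1..Suc n} \<and>
      (\<forall>i<Suc n. double n a b p (flip i x) ! i = double n a b p x ! i)"
    if x: "x \<in> cube_verts (Suc n)" for x
  proof -
    obtain c y where cy: "x = c # y" and y: "y \<in> cube_verts n"
      using x by (auto simp: cube_verts_Suc)
    have py: "length (p y) = n" "distinct (p y)" "set (p y) \<subseteq> {1..n}"
        "\<And>i. i < n \<Longrightarrow> p (flip i y) ! i = p y ! i"
        "\<And>i. i < n \<Longrightarrow> length (p (flip i y)) = n"
      using p y flip_verts[OF y] by (auto simp: distinguishing_palettes_def)
    have "double n a b p (flip i x) ! i = double n a b p x ! i" if "i < Suc n" for i
    proof (cases i)
      \<comment> \<open>Flipping position 0 moves to the other half, where palettes have the same
        head \<open>Suc n\<close>.\<close>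
      case 0
      then show ?thesis by (simp add: cy flip_def)
    next
      case (Suc j)
      then show ?thesis using that py by (simp add: cy flip_Suc)
    qed
    moreover have "Suc n \<notin> transpose a b ` set (p y)" "Suc n \<notin> set (p y)"
      using set_sub[OF py(3)] py(3) by (auto simp: subset_iff)
    moreover have "set (double n a b p x) \<subseteq> {1..Suc n}"
      using set_sub[OF py(3)] py(3) unfolding cy
      by (simp add: atLeastAtMostSuc_conv subset_insertI2)
    ultimately show ?thesis
      using py(1,2) by (simp add: cy distinct_map)
  qed
  have "inj_on (double n a b p) (cube_verts (Suc n))"
  proof (rule inj_onI)
    fix x y
    assume xy: "x \<in> cube_verts (Suc n)" "y \<in> cube_verts (Suc n)"
      "double n a b p x = double n a b p y"
    then obtain c u d v where uv: "x = c # u" "u \<in> cube_verts n" "y = d # v" "v \<in> cube_verts n"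
      by (auto simp: cube_verts_Suc)
    have "map (transpose a b) (p u) \<noteq> p v" "p u \<noteq> map (transpose a b) (p v)"
      using s uv by (metis swap_free_def)+
    with xy(3) have "c = d" "p u = p v"
      by (simp_all add: uv(1,3) inj_eq[OF inj] split: if_splits)
    with p uv show "x = y"
      by (auto simp: distinguishing_palettes_def inj_on_def)
  qed
  with vertex show "distinguishing_palettes (Suc n) (double n a b p)"
    by (simp add: distinguishing_palettes_def)
  \<comment> \<open>Hence \<open>1 \<noteq> Suc n\<close>. Every new palette has head
    \<open>Suc n\<close>, and the exchange turns this head into 1.\<close>
  have "n \<noteq> 0" using ab by simp
  then show "swap_free (Suc n) (double n a b p) 1 (Suc n)"
    by (auto simp: swap_free_def cube_verts_Suc)
qed

text \<open>The first coordinate is the least significant bit of the index.\<close>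

definition table5 :: "nat list list" where
  "table5 = [
   [1,2,3,4,5], [1,5,2,3,4], [3,2,5,4,1], [3,5,1,4,2],
   [1,4,3,2,5], [1,4,2,5,3], [2,4,5,1,3], [2,4,1,3,5],
   [1,3,5,4,2], [1,2,4,3,5], [5,3,2,4,1], [5,2,1,4,3],
   [3,4,5,2,1], [3,2,4,5,1], [5,4,2,1,3], [5,2,1,3,4],
   [3,4,2,1,5], [3,1,5,2,4], [5,4,2,3,1], [5,1,3,4,2],
   [4,1,2,3,5], [4,1,5,2,3], [4,1,2,5,3], [4,1,3,2,5],
   [3,5,4,1,2], [3,1,4,2,5], [2,5,4,3,1], [2,1,5,4,3],
   [5,2,4,3,1], [5,3,4,2,1], [1,2,4,5,3], [1,3,5,2,4]]"

definition palettes5 :: "bool list \<Rightarrow> nat list" where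
  "palettes5 x = table5 ! horner_sum of_bool 2 x"

text \<open>Listing the vertices explicitly makes the claims about dimension 5 decidable by
  evaluation.\<close>

lemma cube_verts_code: "cube_verts n = set (List.n_lists n [False, True])"
  by (auto simp: cube_verts_def set_n_lists)

lemma palettes5:
  shows "distinguishing_palettes 5 palettes5" and "swap_free 5 palettes5 1 2"
proof -
  have "\<forall>x\<in>set (List.n_lists 5 [False, True]). length (palettes5 x) = 5 \<and>
      distinct (palettes5 x) \<and> set (palettes5 x) \<subseteq> set [1..<6] \<and>
      list_all (\<lambda>i. palettes5 (flip i x) ! i = palettes5 x ! i) [0..<5]"
    by code_simp
  \<comment> \<open>Injectivity is checked as distinctness of the list of all 32 palettes.\<close>
  moreover have "distinct (map palettes5 (List.n_lists 5 [False, True]))"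
    by code_simp
  then have "inj_on palettes5 (cube_verts 5)"
    by (simp only: cube_verts_code distinct_map)
  ultimately show "distinguishing_palettes 5 palettes5"
    by (fastforce simp: distinguishing_palettes_def cube_verts_code list_all_iff)
  have "\<forall>x\<in>set (List.n_lists 5 [False, True]). \<forall>y\<in>set (List.n_lists 5 [False, True]).
      map (transpose 1 2) (palettes5 x) \<noteq> palettes5 y"
    by code_simp
  then show "swap_free 5 palettes5 1 2"
    by (simp only: swap_free_def cube_verts_code)
qed

text \<open>The colours \<open>a\<close> and \<open>b\<close> are quantified existentially because
  they change during the induction: they are 1 and 2 in dimension 5, and 1 and the newest colour
  after each doubling.\<close>

lemma distinguishing_palettes_exist:
  assumes "n \<ge> 5"
  shows "\<exists>p a b. distinguishing_palettes n p \<and> a \<in> {1..n} \<and> b \<in> {1..n} \<and> swap_free n p a b"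
  using assms
proof (induction n rule: dec_induct)
  case base
  have "1 \<in> {1..5::nat}" "2 \<in> {1..5::nat}" by auto
  with palettes5 show ?case by blast
next
  case (step n)
  then obtain p a b where
    "distinguishing_palettes n p" "swap_free n p a b" "a \<in> {1..n}" "b \<in> {1..n}"
    by blast
  note distinguishing_palettes_double[OF this]
  moreover have "1 \<in> {1..Suc n}" "Suc n \<in> {1..Suc n}" by auto
  ultimately show ?case by blast
qed

theorem theorem4:
  fixes n :: nat
  assumes "n \<ge> 5"
  shows "(\<exists>k>0. distinguishing_proper_colorable n k) \<and>
         (LEAST k. k > 0 \<and> distinguishing_proper_colorable n k) = n"
proof -
  have n: "n > 0 \<and> distinguishing_proper_colorable n n"
    using assms distinguishing_palettes_exist colorable_if_distinguishing_palettes by fastforce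
  moreover have "n \<le> k" if "distinguishing_proper_colorable n k" for k
    using that proper_coloring_degree_le by (auto simp: distinguishing_proper_colorable_def)
  then have "(LEAST k. k > 0 \<and> distinguishing_proper_colorable n k) = n"
    using n by (intro Least_equality) auto
  ultimately show ?thesis by blast
qed

end
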